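(* Let $K$ be a unitgenerated idempotent semiring. Let $v:K\rightarrow E$ be a surjective homomorphism onto some totally ordered idempotent semifield $E$. Let $L$ be a unitgenerated idempotent semiring containing $K$ as a subsemiring, and let $i:K\rightarrow L$ be the inclusion. Let $\mathcal{O}_K=\{x\in K\mid v(x)\leq 1\}$. Suppose $L$ is extensible as an $\mathcal{O}_K$-algebra. Then there is a totally ordered idempotent semifield $F$, an injective homomorphism $j:E\rightarrow F$, and a homomorphism $w:L\rightarrow F$ such that $w\circ i=j\circ v$.
   Context: Semirings are commutative with $0$ and $1$; homomorphisms preserve $+,\cdot,0,1$. A semiring is idempotent if $x+x=x$ for all $x$; it then carries the canonical partial order $x\leq y\iff x+y=y$. A totally ordered idempotent semifield is an idempotent semiring with $0\neq 1$ in which every nonzero element is a unit and whose canonical order is total. An idempotent semiring is unitgenerated if every element is a finite sum of units (the empty sum being $0$). For an idempotent semiring $R$, an $R$-algebra is a semiring $A$ with a homomorphism $R\to A$. A subset $N$ (subsemigroup, subsemiring, submodule) of an idempotent semigroup $M$ is saturated if $z\leq y$ and $y\in N$ imply $z\in N$. An $R$-module $M$ is finite if there is $m\in M$ such that for every $y\in M$ there is $r\in R$ with $y\leq rm$. An $R$-module $M$ is faithful if $rM\neq 0$ for all nonzero $r\in R$. For $x\in A$, $R\langle x\rangle$ denotes the smallest saturated subsemiring of $A$ containing $x$ and the image of $R$. The element $x$ is integral over $R$ if $R\langle x\rangle$ is a finite $R$-module. The element $x$ is quasiintegral over $R$ if there is an $R\langle x\rangle$-submodule $M\subseteq A$ which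 is finite as an $R$-module and faithful as an $R\langle x\rangle$-module. $A$ is an extensible $R$-algebra if every element of $A$ which is quasiintegral over $R$ is integral over $R$. *)

theory Defs
  imports "HOL-Algebra.Module"
begin

locale idempotent_semiring = semiring R + comm_monoid R for R (structure) +
  assumes add_idem: "x \<in> carrier R \<Longrightarrow> x \<oplus> x = x"

text \<open>Canonical order of the additive semigroup of \<open>M\<close>; also used for modules, whose type
  extends that of rings.\<close>

definition can_le :: "('a, 'm) ring_scheme \<Rightarrow> 'a \<Rightarrow> 'a \<Rightarrow> bool" where
  "can_le M x y \<longleftrightarrow> x \<oplus>\<^bsub>M\<^esub> y = y"

locale tot_ord_idem_semifield = idempotent_semiring F for F (structure) +
  assumes zero_neq_one: "\<zero> \<noteq> \<one>"
    and nonzero_unit: "\<lbrakk>x \<in> carrier F; x \<noteq> \<zero>\<rbrakk> \<Longrightarrow> x \<in> Units F"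
    and total: "\<lbrakk>x \<in> carrier F; y \<in> carrier F\<rbrakk> \<Longrightarrow> can_le F x y \<or> can_le F y x"

locale unitgenerated_idem_semiring = idempotent_semiring R for R (structure) +
  assumes sum_of_units:
    "x \<in> carrier R \<Longrightarrow> \<exists>(n::nat) u. u \<in> {..<n} \<rightarrow> Units R \<and> x = (\<Oplus>k\<in>{..<n}. u k)"

text \<open>Unlike for rings, preservation of \<open>\<zero>\<close> is not implied by \<^const>\<open>ring_hom\<close>.\<close>

definition semiring_hom ::
  "('a, 'm) ring_scheme \<Rightarrow> ('b, 'n) ring_scheme \<Rightarrow> ('a \<Rightarrow> 'b) set" where
  "semiring_hom R S = {h \<in> ring_hom R S. h \<zero>\<^bsub>R\<^esub> = \<zero>\<^bsub>S\<^esub>}"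

definition subsemiring :: "'a set \<Rightarrow> ('a, 'm) ring_scheme \<Rightarrow> bool" where
  "subsemiring S A \<longleftrightarrow> S \<subseteq> carrier A \<and> \<zero>\<^bsub>A\<^esub> \<in> S \<and> \<one>\<^bsub>A\<^esub> \<in> S \<and>
     (\<forall>x\<in>S. \<forall>y\<in>S. x \<oplus>\<^bsub>A\<^esub> y \<in> S \<and> x \<otimes>\<^bsub>A\<^esub> y \<in> S)"

definition saturated :: "'a set \<Rightarrow> ('a, 'm) ring_scheme \<Rightarrow> bool" where
  "saturated N M \<longleftrightarrow> (\<forall>z\<in>carrier M. \<forall>y\<in>N. can_le M z y \<longrightarrow> z \<in> N)"

text \<open>The type of modules is that of \<^locale>\<open>module\<close>: a ring record extended by a scalar
  multiplication, whose fields \<open>mult\<close> and \<open>one\<close> are irrelevant. The locale itself is not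
  usable, as it demands additive inverses.\<close>

definition subsemimodule ::
  "('r, 'k) ring_scheme \<Rightarrow> 'a set \<Rightarrow> ('r, 'a, 'm) module_scheme \<Rightarrow> bool" where
  "subsemimodule R N M \<longleftrightarrow> N \<subseteq> carrier M \<and> \<zero>\<^bsub>M\<^esub> \<in> N \<and>
     (\<forall>x\<in>N. \<forall>y\<in>N. x \<oplus>\<^bsub>M\<^esub> y \<in> N) \<and> (\<forall>r\<in>carrier R. \<forall>x\<in>N. r \<odot>\<^bsub>M\<^esub> x \<in> N)"

definition finite_semimodule ::
  "('r, 'k) ring_scheme \<Rightarrow> ('r, 'a, 'm) module_scheme \<Rightarrow> bool" where
  "finite_semimodule R M \<longleftrightarrow>
     (\<exists>m\<in>carrier M. \<forall>y\<in>carrier M. \<exists>r\<in>carrier R. can_le M y (r \<odot>\<^bsub>M\<^esub> m))"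

definition faithful_semimodule ::
  "('r, 'k) ring_scheme \<Rightarrow> ('r, 'a, 'm) module_scheme \<Rightarrow> bool" where
  "faithful_semimodule R M \<longleftrightarrow>
     (\<forall>r\<in>carrier R. r \<noteq> \<zero>\<^bsub>R\<^esub> \<longrightarrow> (\<exists>m\<in>carrier M. r \<odot>\<^bsub>M\<^esub> m \<noteq> \<zero>\<^bsub>M\<^esub>))"

text \<open>\<open>N \<subseteq> carrier A\<close> as a module over a semiring with structure map \<open>\<phi>\<close> to \<open>A\<close>. It is used
  both for the base semiring of an algebra and, with \<open>\<phi>\<close> the inclusion, for subsemirings of \<open>A\<close>.\<close>

definition alg_module :: "('a, 'm) ring_scheme \<Rightarrow> ('r \<Rightarrow> 'a) \<Rightarrow> 'a set \<Rightarrow> ('r, 'a) module" where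
  "alg_module A \<phi> N = \<lparr>carrier = N, mult = mult A, one = \<one>\<^bsub>A\<^esub>, zero = \<zero>\<^bsub>A\<^esub>, add = add A,
     smult = (\<lambda>r a. \<phi> r \<otimes>\<^bsub>A\<^esub> a)\<rparr>"

text \<open>In the definitions below \<open>R\<close> is an idempotent semiring, \<open>A\<close> a commutative semiring and
  \<open>\<phi> \<in> semiring_hom R A\<close> the structure map of \<open>A\<close> as an \<open>R\<close>-algebra. \<open>adjoin R A \<phi> x\<close> is the
  saturated subsemiring \<open>R\<langle>x\<rangle>\<close>.\<close>

definition adjoin ::
  "('r, 'k) ring_scheme \<Rightarrow> ('a, 'm) ring_scheme \<Rightarrow> ('r \<Rightarrow> 'a) \<Rightarrow> 'a \<Rightarrow> 'a set" where
  "adjoin R A \<phi> x =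
     \<Inter>{S. subsemiring S A \<and> saturated S A \<and> \<phi> ` carrier R \<subseteq> S \<and> x \<in> S}"

definition integral_over ::
  "('r, 'k) ring_scheme \<Rightarrow> ('a, 'm) ring_scheme \<Rightarrow> ('r \<Rightarrow> 'a) \<Rightarrow> 'a \<Rightarrow> bool" where
  "integral_over R A \<phi> x \<longleftrightarrow> finite_semimodule R (alg_module A \<phi> (adjoin R A \<phi> x))"

definition quasiintegral_over ::
  "('r, 'k) ring_scheme \<Rightarrow> ('a, 'm) ring_scheme \<Rightarrow> ('r \<Rightarrow> 'a) \<Rightarrow> 'a \<Rightarrow> bool" where
  "quasiintegral_over R A \<phi> x \<longleftrightarrow>
     (let Rx = A\<lparr>carrier := adjoin R A \<phi> x\<rparr> in
      \<exists>N. subsemimodule Rx N (alg_module A (\<lambda>a. a) (carrier A)) \<and>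
          finite_semimodule R (alg_module A \<phi> N) \<and>
          faithful_semimodule Rx (alg_module A (\<lambda>a. a) N))"

definition extensible ::
  "('r, 'k) ring_scheme \<Rightarrow> ('a, 'm) ring_scheme \<Rightarrow> ('r \<Rightarrow> 'a) \<Rightarrow> bool" where
  "extensible R A \<phi> \<longleftrightarrow>
     (\<forall>x\<in>carrier A. quasiintegral_over R A \<phi> x \<longrightarrow> integral_over R A \<phi> x)"

text \<open>\<open>\<O>\<^sub>K\<close> for \<open>v : K \<rightarrow> E\<close>, with \<open>K\<close> given by its carrier set.\<close>

definition val_ring :: "'a set \<Rightarrow> ('e, 'n) ring_scheme \<Rightarrow> ('a \<Rightarrow> 'e) \<Rightarrow> 'a set" where
  "val_ring K E v = {x \<in> K. can_le E (v x) \<one>\<^bsub>E\<^esub>}"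

end

theory Submission
  imports Defs
begin

text \<open>Among the saturated subsemirings of \<open>L\<close> containing \<open>\<O>\<^sub>K\<close>, take a maximal \<open>A\<close> for which no
  inequality \<open>s p \<le> a p\<close> holds with \<open>a \<in> A\<close>, \<open>p \<ge> 1\<close>, \<open>s \<in> K\<close> and \<open>v s > 1\<close>. Extensibility gives the
  starting point of Zorn's lemma: for the saturation of \<open>\<O>\<^sub>K\<close>, such an inequality makes \<open>s\<close>
  quasiintegral, hence integral, hence \<open>v s \<le> 1\<close>. Maximality forces \<open>u \<in> A\<close> or \<open>u\<^sup>-\<^sup>1 \<in> A\<close> for every
  unit \<open>u\<close> of \<open>L\<close>. Since \<open>L\<close> is generated by units, the preorder \<open>x \<le> a y\<close> for some \<open>a \<in> A\<close> is then
  total, its quotient \<open>F\<close> is a semifield, and on \<open>K\<close> it is the preorder defined by \<open>v\<close>.\<close>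

notation can_le (infix "\<preceq>\<index>" 50)

context idempotent_semiring
begin

lemma le_refl: "x \<in> carrier R \<Longrightarrow> x \<preceq> x"
  by (simp add: can_le_def add_idem)

lemma le_trans:
  assumes "x \<preceq> y" "y \<preceq> z" "x \<in> carrier R" "y \<in> carrier R" "z \<in> carrier R"
  shows "x \<preceq> z"
  using assms unfolding can_le_def by (metis a_assoc)

lemma le_antisym:
  "\<lbrakk>x \<preceq> y; y \<preceq> x; x \<in> carrier R; y \<in> carrier R\<rbrakk> \<Longrightarrow> x = y"
  unfolding can_le_def by (metis a_comm)

lemma zero_le: "x \<in> carrier R \<Longrightarrow> \<zero> \<preceq> x"
  by (simp add: can_le_def)

lemma le_zero: "\<lbrakk>x \<preceq> \<zero>; x \<in> carrier R\<rbrakk> \<Longrightarrow> x = \<zero>"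
  by (simp add: can_le_def)

lemma le_add1: "\<lbrakk>x \<in> carrier R; y \<in> carrier R\<rbrakk> \<Longrightarrow> x \<preceq> x \<oplus> y"
  unfolding can_le_def by (metis a_assoc add_idem)

lemma le_add2: "\<lbrakk>x \<in> carrier R; y \<in> carrier R\<rbrakk> \<Longrightarrow> y \<preceq> x \<oplus> y"
  by (metis a_comm le_add1)

lemma add_least:
  "\<lbrakk>x \<preceq> z; y \<preceq> z; x \<in> carrier R; y \<in> carrier R; z \<in> carrier R\<rbrakk> \<Longrightarrow> x \<oplus> y \<preceq> z"
  unfolding can_le_def by (metis a_assoc)

lemma add_mono:
  assumes "a \<preceq> b" "c \<preceq> d"
    and "a \<in> carrier R" "b \<in> carrier R" "c \<in> carrier R" "d \<in> carrier R"
  shows "a \<oplus> c \<preceq> b \<oplus> d"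
  using assms by (meson add_least le_add1 le_add2 le_trans add.m_closed)

lemma mult_left_mono:
  "\<lbrakk>a \<preceq> b; a \<in> carrier R; b \<in> carrier R; c \<in> carrier R\<rbrakk> \<Longrightarrow> c \<otimes> a \<preceq> c \<otimes> b"
  unfolding can_le_def by (metis r_distr)

lemma mult_right_mono:
  "\<lbrakk>a \<preceq> b; a \<in> carrier R; b \<in> carrier R; c \<in> carrier R\<rbrakk> \<Longrightarrow> a \<otimes> c \<preceq> b \<otimes> c"
  unfolding can_le_def by (metis l_distr)

lemma mult_mono:
  assumes "a \<preceq> b" "c \<preceq> d"
    and "a \<in> carrier R" "b \<in> carrier R" "c \<in> carrier R" "d \<in> carrier R"
  shows "a \<otimes> c \<preceq> b \<otimes> d"
  using assms by (meson le_trans mult_left_mono mult_right_mono m_closed)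

lemma one_le_mult:
  "\<lbrakk>\<one> \<preceq> a; \<one> \<preceq> b; a \<in> carrier R; b \<in> carrier R\<rbrakk> \<Longrightarrow> \<one> \<preceq> a \<otimes> b"
  using mult_mono[of \<one> a \<one> b] by simp

lemma one_le_pow: "\<lbrakk>\<one> \<preceq> a; a \<in> carrier R\<rbrakk> \<Longrightarrow> \<one> \<preceq> a [^] (n::nat)"
  by (induction n) (simp_all add: le_refl one_le_mult)

lemma pow_mono_exp:
  assumes "\<one> \<preceq> a" "a \<in> carrier R"
  shows "a [^] (n::nat) \<preceq> a [^] (n + m)" "a [^] (n::nat) \<preceq> a [^] (m + n)"
proof -
  show "a [^] n \<preceq> a [^] (n + m)"
    using mult_left_mono[of \<one> "a [^] m" "a [^] n"] assms one_le_pow[of a m]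
    by (simp add: nat_pow_mult)
  then show "a [^] n \<preceq> a [^] (m + n)"
    by (simp add: add.commute)
qed

lemma pow_mono:
  "\<lbrakk>a \<preceq> b; a \<in> carrier R; b \<in> carrier R\<rbrakk> \<Longrightarrow> a [^] (n::nat) \<preceq> b [^] n"
  by (induction n) (simp_all add: le_refl mult_mono)

lemma pow_one_add_le:
  assumes u: "u \<in> carrier R"
  shows "(\<one> \<oplus> u) [^] (n::nat) \<preceq> \<one> \<oplus> u \<otimes> (\<one> \<oplus> u) [^] n"
proof (induction n)
  case 0
  show ?case using u by (simp add: le_add1)
next
  case (Suc n)
  let ?w = "\<one> \<oplus> u" and ?r = "\<one> \<oplus> u \<otimes> (\<one> \<oplus> u) [^] Suc n"
  have c: "?w \<in> carrier R" "?r \<in> carrier R" using u by auto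
  have "\<one> \<preceq> ?w [^] Suc n" using u by (intro one_le_pow le_add1) auto
  then have "u \<preceq> u \<otimes> ?w [^] Suc n"
    using mult_left_mono[of \<one> "?w [^] Suc n" u] u by simp
  then have "?w \<preceq> ?r"
    using u by (intro add_mono le_refl) (auto simp del: nat_pow_Suc)
  moreover have "u \<otimes> ?w [^] Suc n \<preceq> ?r"
    using u by (intro le_add2) auto
  ultimately have 1: "?w \<oplus> u \<otimes> ?w [^] Suc n \<preceq> ?r"
    using u c by (blast intro: add_least nat_pow_closed m_closed)
  have "?w [^] Suc n \<preceq> (\<one> \<oplus> u \<otimes> ?w [^] n) \<otimes> ?w"
    using Suc u by (simp add: mult_right_mono)
  also have "(\<one> \<oplus> u \<otimes> ?w [^] n) \<otimes> ?w = ?w \<oplus> u \<otimes> ?w [^] Suc n"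
    using u c by (simp add: l_distr m_assoc)
  finally show ?case using 1 u c by (blast intro: le_trans)
qed

lemma pow_one_add_split:
  assumes u: "u \<in> carrier R"
  shows "(\<one> \<oplus> u) [^] (n + m :: nat) \<preceq> (\<one> \<oplus> u) [^] m \<oplus> u [^] m \<otimes> (\<one> \<oplus> u) [^] n"
proof (induction m)
  case 0
  show ?case using u by (simp add: le_add2)
next
  case (Suc m)
  let ?w = "\<one> \<oplus> u"
  have c: "?w \<in> carrier R" using u by auto
  have 1: "\<one> \<preceq> ?w" "u \<preceq> ?w" using u by (auto intro: le_add1 le_add2)
  let ?r = "?w [^] Suc m \<oplus> u [^] Suc m \<otimes> ?w [^] n"
  have rc: "?r \<in> carrier R" using u by auto
  have "u [^] m \<preceq> ?w [^] m" using pow_mono 1 u c by blast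
  moreover have "?w [^] m \<preceq> ?w [^] Suc m"
    using pow_mono_exp(1)[of ?w m 1] 1 c by simp
  ultimately have "u [^] m \<preceq> ?w [^] Suc m"
    using u c by (meson le_trans nat_pow_closed)
  then have 2: "u [^] m \<oplus> u [^] Suc m \<otimes> ?w [^] n \<preceq> ?r"
    using u c by (intro add_mono le_refl) auto
  have "u [^] m \<otimes> ?w [^] n \<preceq> u [^] m \<otimes> (\<one> \<oplus> u \<otimes> ?w [^] n)"
    using u c by (intro mult_left_mono pow_one_add_le) auto
  also have "\<dots> = u [^] m \<oplus> u [^] Suc m \<otimes> ?w [^] n"
    using u c by (simp add: r_distr m_assoc)
  finally have 3: "u [^] m \<otimes> ?w [^] n \<preceq> ?r"
    using 2 u c rc by (meson le_trans nat_pow_closed m_closed add.m_closed)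
  have "u [^] m \<otimes> ?w [^] n \<otimes> u = u [^] Suc m \<otimes> ?w [^] n"
    using u c by (simp add: m_ac)
  then have 4: "u [^] m \<otimes> ?w [^] n \<otimes> u \<preceq> ?r"
    using u c by (simp add: le_add2)
  have 5: "?w [^] m \<otimes> ?w \<preceq> ?r"
    using u c by (simp add: le_add1)
  have "?w [^] (n + Suc m) \<preceq> (?w [^] m \<oplus> u [^] m \<otimes> ?w [^] n) \<otimes> ?w"
    using Suc u c by (simp add: mult_right_mono)
  also have "\<dots> = ?w [^] m \<otimes> ?w \<oplus> (u [^] m \<otimes> ?w [^] n \<oplus> u [^] m \<otimes> ?w [^] n \<otimes> u)"
    using u c by (simp add: l_distr r_distr m_assoc a_ac)
  finally have 6: "?w [^] (n + Suc m) \<preceq> \<dots>" .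
  have "?w [^] m \<otimes> ?w \<oplus> (u [^] m \<otimes> ?w [^] n \<oplus> u [^] m \<otimes> ?w [^] n \<otimes> u) \<preceq> ?r"
    using 3 4 5 u c rc by (intro add_least) auto
  from le_trans[OF 6 this] show ?case
    using u c rc by simp
qed

end

lemma (in unitgenerated_idem_semiring) unit_sum_induct [consumes 1, case_names zero add]:
  assumes x: "x \<in> carrier R"
    and zero: "P \<zero>"
    and add: "\<And>u y. \<lbrakk>u \<in> Units R; y \<in> carrier R; P y\<rbrakk> \<Longrightarrow> P (u \<oplus> y)"
  shows "P x"
proof -
  obtain n :: nat and u where u: "u \<in> {..<n} \<rightarrow> Units R" and x: "x = (\<Oplus>k\<in>{..<n}. u k)"
    using sum_of_units[OF x] by blast
  have "(\<Oplus>k\<in>{..<m}. u k) \<in> carrier R \<and> P (\<Oplus>k\<in>{..<m}. u k)" if "m \<le> n" for m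
    using that
  proof (induction m)
    case 0
    then show ?case using zero by simp
  next
    case (Suc m)
    have "u m \<in> Units R" using u Suc.prems by auto
    moreover have "u \<in> {..<m} \<rightarrow> carrier R" using u Suc.prems by (auto simp: Pi_iff)
    ultimately have "(\<Oplus>k\<in>{..<Suc m}. u k) = u m \<oplus> (\<Oplus>k\<in>{..<m}. u k)"
      by (simp add: lessThan_Suc Units_closed)
    then show ?case using Suc add \<open>u m \<in> Units R\<close> by auto
  qed
  then show ?thesis using x by blast
qed

section \<open>The quotient of a semiring by a saturated subsemiring\<close>

context idempotent_semiring
begin

definition pre_le :: "'a set \<Rightarrow> 'a \<Rightarrow> 'a \<Rightarrow> bool" where
  "pre_le A x y \<longleftrightarrow> (\<exists>a\<in>A. x \<preceq> a \<otimes> y)"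

definition pre_class :: "'a set \<Rightarrow> 'a \<Rightarrow> 'a set" where
  "pre_class A x = {y \<in> carrier R. pre_le A x y \<and> pre_le A y x}"

definition class_rep :: "'a set \<Rightarrow> 'a set \<Rightarrow> 'a" where
  "class_rep A X = (SOME x. x \<in> carrier R \<and> pre_class A x = X)"

definition pre_quot :: "'a set \<Rightarrow> 'a set ring" where
  "pre_quot A = \<lparr>carrier = pre_class A ` carrier R,
     mult = \<lambda>X Y. pre_class A (class_rep A X \<otimes> class_rep A Y),
     one = pre_class A \<one>, zero = pre_class A \<zero>,
     add = \<lambda>X Y. pre_class A (class_rep A X \<oplus> class_rep A Y)\<rparr>"

context
  fixes A assumes A: "subsemiring A R"
begin

lemma A_closed:
  "a \<in> A \<Longrightarrow> a \<in> carrier R" "\<zero> \<in> A" "\<one> \<in> A"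
  "\<lbrakk>a \<in> A; b \<in> A\<rbrakk> \<Longrightarrow> a \<oplus> b \<in> A" "\<lbrakk>a \<in> A; b \<in> A\<rbrakk> \<Longrightarrow> a \<otimes> b \<in> A"
  using A by (auto simp: subsemiring_def)

lemma le_imp_pre_le:
  "\<lbrakk>x \<preceq> y; x \<in> carrier R; y \<in> carrier R\<rbrakk> \<Longrightarrow> pre_le A x y"
  unfolding pre_le_def using A_closed(3) by (intro bexI[of _ \<one>]) auto

lemma pre_le_refl: "x \<in> carrier R \<Longrightarrow> pre_le A x x"
  by (simp add: le_imp_pre_le le_refl)

lemma pre_le_trans:
  assumes "pre_le A x y" "pre_le A y z" and c: "x \<in> carrier R" "y \<in> carrier R" "z \<in> carrier R"
  shows "pre_le A x z"
proof -
  obtain a b where ab: "a \<in> A" "b \<in> A" "x \<preceq> a \<otimes> y" "y \<preceq> b \<otimes> z"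
    using assms by (auto simp: pre_le_def)
  have "a \<otimes> y \<preceq> a \<otimes> (b \<otimes> z)"
    using ab c A_closed by (intro mult_left_mono) auto
  then have "x \<preceq> a \<otimes> (b \<otimes> z)"
    using ab c A_closed(1) by (meson le_trans m_closed)
  then show ?thesis unfolding pre_le_def
    using ab c A_closed by (intro bexI[of _ "a \<otimes> b"]) (auto simp: m_assoc)
qed

lemma pre_le_add_least:
  assumes "pre_le A x z" "pre_le A y z" and c: "x \<in> carrier R" "y \<in> carrier R" "z \<in> carrier R"
  shows "pre_le A (x \<oplus> y) z"
proof -
  obtain a b where ab: "a \<in> A" "b \<in> A" "x \<preceq> a \<otimes> z" "y \<preceq> b \<otimes> z"
    using assms by (auto simp: pre_le_def)
  then have "x \<oplus> y \<preceq> (a \<oplus> b) \<otimes> z"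
    using c A_closed(1) by (simp add: l_distr add_mono)
  then show ?thesis unfolding pre_le_def using ab A_closed(4) by blast
qed

lemma pre_le_add_mono:
  assumes "pre_le A x x'" "pre_le A y y'"
    and c: "x \<in> carrier R" "y \<in> carrier R" "x' \<in> carrier R" "y' \<in> carrier R"
  shows "pre_le A (x \<oplus> y) (x' \<oplus> y')"
proof -
  have "pre_le A x' (x' \<oplus> y')" "pre_le A y' (x' \<oplus> y')"
    using c by (simp_all add: le_imp_pre_le le_add1 le_add2)
  then show ?thesis
    using assms by (meson pre_le_add_least pre_le_trans add.m_closed)
qed

lemma pre_le_mult_mono:
  assumes "pre_le A x x'" "pre_le A y y'"
    and c: "x \<in> carrier R" "y \<in> carrier R" "x' \<in> carrier R" "y' \<in> carrier R"
  shows "pre_le A (x \<otimes> y) (x' \<otimes> y')"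
proof -
  obtain a b where ab: "a \<in> A" "b \<in> A" "x \<preceq> a \<otimes> x'" "y \<preceq> b \<otimes> y'"
    using assms by (auto simp: pre_le_def)
  then have "x \<otimes> y \<preceq> (a \<otimes> x') \<otimes> (b \<otimes> y')"
    using c A_closed(1) by (intro mult_mono) auto
  also have "(a \<otimes> x') \<otimes> (b \<otimes> y') = (a \<otimes> b) \<otimes> (x' \<otimes> y')"
    using ab c A_closed(1) by (simp add: m_ac)
  finally show ?thesis unfolding pre_le_def using ab A_closed(5) by blast
qed

lemma pre_class_eq_iff:
  assumes "x \<in> carrier R" "y \<in> carrier R"
  shows "pre_class A x = pre_class A y \<longleftrightarrow> pre_le A x y \<and> pre_le A y x"
proof
  assume "pre_class A x = pre_class A y"
  moreover have "y \<in> pre_class A y" using assms by (simp add: pre_class_def pre_le_refl)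
  ultimately show "pre_le A x y \<and> pre_le A y x" by (auto simp: pre_class_def)
next
  assume "pre_le A x y \<and> pre_le A y x"
  then show "pre_class A x = pre_class A y"
    unfolding pre_class_def using assms by (blast intro: pre_le_trans)
qed

lemma class_rep:
  assumes "x \<in> carrier R"
  shows "class_rep A (pre_class A x) \<in> carrier R \<and>
    pre_class A (class_rep A (pre_class A x)) = pre_class A x"
  unfolding class_rep_def by (rule someI[of _ x]) (simp add: assms)

lemma pre_quot_simps:
  "carrier (pre_quot A) = pre_class A ` carrier R"
  "\<one>\<^bsub>pre_quot A\<^esub> = pre_class A \<one>"
  "\<zero>\<^bsub>pre_quot A\<^esub> = pre_class A \<zero>"
  by (simp_all add: pre_quot_def)

lemma pre_quot_ops:
  assumes "x \<in> carrier R" "y \<in> carrier R"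
  shows "pre_class A x \<oplus>\<^bsub>pre_quot A\<^esub> pre_class A y = pre_class A (x \<oplus> y)"
    and "pre_class A x \<otimes>\<^bsub>pre_quot A\<^esub> pre_class A y = pre_class A (x \<otimes> y)"
proof -
  let ?x = "class_rep A (pre_class A x)" and ?y = "class_rep A (pre_class A y)"
  have c: "?x \<in> carrier R" "?y \<in> carrier R" using class_rep assms by auto
  have e: "pre_le A ?x x" "pre_le A x ?x" "pre_le A ?y y" "pre_le A y ?y"
    using class_rep[of x] class_rep[of y] c assms by (simp_all add: pre_class_eq_iff)
  show "pre_class A x \<oplus>\<^bsub>pre_quot A\<^esub> pre_class A y = pre_class A (x \<oplus> y)"
    using c e assms by (simp add: pre_quot_def pre_class_eq_iff pre_le_add_mono)
  show "pre_class A x \<otimes>\<^bsub>pre_quot A\<^esub> pre_class A y = pre_class A (x \<otimes> y)"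
    using c e assms by (simp add: pre_quot_def pre_class_eq_iff pre_le_mult_mono)
qed

lemma pre_class_hom: "pre_class A \<in> semiring_hom R (pre_quot A)"
  unfolding semiring_hom_def
  by (auto intro!: ring_hom_memI simp: pre_quot_simps pre_quot_ops)

lemma can_le_pre_quot:
  assumes "x \<in> carrier R" "y \<in> carrier R"
  shows "can_le (pre_quot A) (pre_class A x) (pre_class A y) \<longleftrightarrow> pre_le A x y"
proof -
  have "pre_le A (x \<oplus> y) y \<longleftrightarrow> pre_le A x y"
    using assms
    by (meson add.m_closed le_add1 le_imp_pre_le pre_le_add_least pre_le_refl pre_le_trans)
  moreover have "pre_le A y (x \<oplus> y)"
    using assms by (simp add: le_imp_pre_le le_add2)
  ultimately show ?thesis
    using assms by (simp add: can_le_def pre_quot_ops pre_class_eq_iff)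
qed

lemma idempotent_semiring_pre_quot: "idempotent_semiring (pre_quot A)"
  by unfold_locales
    (auto simp: pre_quot_simps pre_quot_ops a_assoc m_assoc l_distr r_distr add_idem;
     simp add: a_comm m_comm)+

end

end

section \<open>Extending the valuation\<close>

locale valued_subsemiring =
  unitgenerated_idem_semiring L + E: tot_ord_idem_semifield E
  for L :: "('a, 'm) ring_scheme" (structure) and E :: "('e, 'n) ring_scheme" +
  fixes K :: "'a set" and v :: "'a \<Rightarrow> 'e"
  assumes K_subsemiring: "subsemiring K L"
    and K_unitgenerated: "unitgenerated_idem_semiring (L\<lparr>carrier := K\<rparr>)"
    and v_hom: "v \<in> semiring_hom (L\<lparr>carrier := K\<rparr>) E"
    and v_surj: "v ` K = carrier E"
begin

sublocale K: unitgenerated_idem_semiring "L\<lparr>carrier := K\<rparr>"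
  by (rule K_unitgenerated)

abbreviation vle (infix "\<preceq>\<^sub>v" 50) where "x \<preceq>\<^sub>v y \<equiv> can_le E (v x) (v y)"

abbreviation val ("\<O>") where "\<O> \<equiv> val_ring K E v"

lemma K_closed:
  "x \<in> K \<Longrightarrow> x \<in> carrier L" "\<zero> \<in> K" "\<one> \<in> K"
  "\<lbrakk>x \<in> K; y \<in> K\<rbrakk> \<Longrightarrow> x \<oplus> y \<in> K" "\<lbrakk>x \<in> K; y \<in> K\<rbrakk> \<Longrightarrow> x \<otimes> y \<in> K"
  using K_subsemiring by (auto simp: subsemiring_def)

lemma pow_K: "x \<in> K \<Longrightarrow> x [^] (n::nat) \<in> K"
  by (induction n) (simp_all add: K_closed)

lemma v_closed [simp]: "x \<in> K \<Longrightarrow> v x \<in> carrier E"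
  using v_surj by auto

lemma v_simps [simp]:
  "v \<zero> = \<zero>\<^bsub>E\<^esub>" "v \<one> = \<one>\<^bsub>E\<^esub>"
  "\<lbrakk>x \<in> K; y \<in> K\<rbrakk> \<Longrightarrow> v (x \<oplus> y) = v x \<oplus>\<^bsub>E\<^esub> v y"
  "\<lbrakk>x \<in> K; y \<in> K\<rbrakk> \<Longrightarrow> v (x \<otimes> y) = v x \<otimes>\<^bsub>E\<^esub> v y"
  using v_hom by (auto simp: semiring_hom_def ring_hom_def)

lemma v_mono: "\<lbrakk>x \<preceq> y; x \<in> K; y \<in> K\<rbrakk> \<Longrightarrow> x \<preceq>\<^sub>v y"
  unfolding can_le_def by (metis v_simps(3))

lemma v_pow: "x \<in> K \<Longrightarrow> v (x [^] (n::nat)) = v x [^]\<^bsub>E\<^esub> n"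
  by (induction n) (simp_all add: pow_K)

lemma val_iff: "x \<in> \<O> \<longleftrightarrow> x \<in> K \<and> can_le E (v x) \<one>\<^bsub>E\<^esub>"
  by (simp add: val_ring_def)

lemma val_K: "x \<in> \<O> \<Longrightarrow> x \<in> K"
  by (simp add: val_iff)

lemma val_carrier: "x \<in> \<O> \<Longrightarrow> x \<in> carrier L"
  by (simp add: val_K K_closed)

lemma val_closed:
  "\<zero> \<in> \<O>" "\<one> \<in> \<O>" "\<lbrakk>x \<in> \<O>; y \<in> \<O>\<rbrakk> \<Longrightarrow> x \<oplus> y \<in> \<O>" "\<lbrakk>x \<in> \<O>; y \<in> \<O>\<rbrakk> \<Longrightarrow> x \<otimes> y \<in> \<O>"
  using E.mult_mono[of "v x" "\<one>\<^bsub>E\<^esub>" "v y" "\<one>\<^bsub>E\<^esub>"]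
  by (auto simp: val_iff K_closed E.zero_le E.le_refl E.add_least)

lemma not_val: "\<lbrakk>s \<in> K; s \<notin> \<O>\<rbrakk> \<Longrightarrow> can_le E \<one>\<^bsub>E\<^esub> (v s)"
  using E.total[of "v s" "\<one>\<^bsub>E\<^esub>"] by (simp add: val_iff)

lemma dominant_unit:
  assumes "x \<in> K" "x \<noteq> \<zero>"
  shows "\<exists>u\<in>Units (L\<lparr>carrier := K\<rparr>). u \<preceq> x \<and> v u = v x"
proof -
  have "x \<in> carrier (L\<lparr>carrier := K\<rparr>)" using assms by simp
  then have "x = \<zero> \<or> (\<exists>u\<in>Units (L\<lparr>carrier := K\<rparr>). u \<preceq> x \<and> v u = v x)"
  proof (induction x rule: K.unit_sum_induct)
    case zero
    then show ?case by simp
  next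
    case (add u y)
    have uK: "u \<in> K" and yK: "y \<in> K" using add by (auto simp: Units_def)
    have c: "u \<in> carrier L" "y \<in> carrier L" using uK yK K_closed by auto
    show ?case
    proof (cases "y \<preceq>\<^sub>v u")
      case True
      then have "v (u \<oplus> y) = v u"
        using uK yK E.a_comm[of "v u" "v y"] by (simp add: can_le_def)
      then show ?thesis using add(1) le_add1[OF c] by auto
    next
      case False
      then have "y \<noteq> \<zero>" using uK E.zero_le by auto
      then obtain t where t: "t \<in> Units (L\<lparr>carrier := K\<rparr>)" "t \<preceq> y" "v t = v y"
        using add(3) by auto
      have "u \<preceq>\<^sub>v y" using False E.total uK yK v_closed by blast
      then have "v (u \<oplus> y) = v y" using uK yK by (simp add: can_le_def)
      moreover have "t \<in> carrier L" using t(1) K_closed by (auto simp: Units_def)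
      then have "t \<preceq> u \<oplus> y" using t(2) le_add2[OF c] c by (meson le_trans add.m_closed)
      ultimately show ?thesis using t by auto
    qed
  qed
  then show ?thesis using assms by blast
qed

lemma v_eq_zero: "\<lbrakk>x \<in> K; v x = \<zero>\<^bsub>E\<^esub>\<rbrakk> \<Longrightarrow> x = \<zero>"
proof (rule ccontr)
  assume x: "x \<in> K" "v x = \<zero>\<^bsub>E\<^esub>" "x \<noteq> \<zero>"
  obtain u t where u: "v u = v x" "u \<in> K" "t \<in> K" "t \<otimes> u = \<one>"
    using dominant_unit[OF x(1,3)] by (auto simp: Units_def)
  then have "v t \<otimes>\<^bsub>E\<^esub> v u = \<one>\<^bsub>E\<^esub>" using v_simps by metis
  then show False using u x E.zero_neq_one by simp
qed

lemma val_divides: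
  assumes "x \<in> K" "y \<in> K" "x \<preceq>\<^sub>v y"
  shows "\<exists>r\<in>\<O>. x \<preceq> r \<otimes> y"
proof (cases "y = \<zero>")
  case True
  then have "x = \<zero>" using assms v_eq_zero[of x] E.le_zero by simp
  then show ?thesis using True val_closed(2) by (intro bexI[of _ \<one>]) (auto simp: le_refl)
next
  case False
  obtain u t where u: "u \<preceq> y" "v u = v y" "u \<in> K" "t \<in> K" "t \<otimes> u = \<one>"
    using dominant_unit[OF assms(2) False] by (auto simp: Units_def)
  have c: "x \<in> carrier L" "y \<in> carrier L" "u \<in> carrier L" "t \<in> carrier L"
    using assms u K_closed by auto
  have "v u \<otimes>\<^bsub>E\<^esub> v t = \<one>\<^bsub>E\<^esub>"
    using u assms(2) E.m_comm[of "v u" "v t"] v_simps(4)[of t u] by simp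
  then have "x \<otimes> t \<in> \<O>"
    using E.mult_right_mono[of "v x" "v y" "v t"] assms u by (simp add: val_iff K_closed)
  moreover have "x = (x \<otimes> t) \<otimes> u" using u c by (simp add: m_assoc)
  then have "x \<preceq> (x \<otimes> t) \<otimes> y" using mult_left_mono[of u y "x \<otimes> t"] u c by simp
  ultimately show ?thesis by blast
qed

text \<open>The condition \<open>\<one> \<preceq> p\<close> makes \<open>p\<close> a cancellable multiplier in the sense that \<open>c \<otimes> p = \<zero>\<close>
  forces \<open>c = \<zero>\<close>, and it is stable under products. Taking \<open>p = \<one>\<close> shows that an admissible set
  meets \<open>K\<close> in \<open>\<O>\<close> only, but this weaker property is not preserved in the adjunction step.\<close>

definition admissible :: "'a set \<Rightarrow> bool" where
  "admissible A \<longleftrightarrow> subsemiring A L \<and> saturated A L \<and> \<O> \<subseteq> A \<and>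
     (\<forall>p\<in>carrier L. \<forall>a\<in>A. \<forall>s\<in>K - \<O>. \<one> \<preceq> p \<longrightarrow> \<not> s \<otimes> p \<preceq> a \<otimes> p)"

lemma admissible_closed:
  assumes "admissible A"
  shows "a \<in> A \<Longrightarrow> a \<in> carrier L" "\<zero> \<in> A" "\<one> \<in> A"
    "\<lbrakk>a \<in> A; b \<in> A\<rbrakk> \<Longrightarrow> a \<oplus> b \<in> A" "\<lbrakk>a \<in> A; b \<in> A\<rbrakk> \<Longrightarrow> a \<otimes> b \<in> A"
    "\<lbrakk>x \<preceq> a; a \<in> A; x \<in> carrier L\<rbrakk> \<Longrightarrow> x \<in> A" "r \<in> \<O> \<Longrightarrow> r \<in> A"
  using assms by (auto simp: admissible_def subsemiring_def saturated_def)

lemma admissibleD: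
  "\<lbrakk>admissible A; s \<otimes> p \<preceq> a \<otimes> p; \<one> \<preceq> p; p \<in> carrier L; a \<in> A; s \<in> K\<rbrakk> \<Longrightarrow> s \<in> \<O>"
  by (auto simp: admissible_def)

lemma saturated_down_closure:
  assumes B: "B \<subseteq> carrier L" "\<zero> \<in> B" "\<one> \<in> B"
    and add: "\<And>b c. \<lbrakk>b \<in> B; c \<in> B\<rbrakk> \<Longrightarrow> \<exists>d\<in>B. b \<oplus> c \<preceq> d"
    and mult: "\<And>b c. \<lbrakk>b \<in> B; c \<in> B\<rbrakk> \<Longrightarrow> \<exists>d\<in>B. b \<otimes> c \<preceq> d"
  defines "D \<equiv> {x \<in> carrier L. \<exists>b\<in>B. x \<preceq> b}"
  shows "subsemiring D L" "saturated D L" "B \<subseteq> D"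
proof -
  have "x \<oplus> y \<in> D" "x \<otimes> y \<in> D" if xy: "x \<in> D" "y \<in> D" for x y
  proof -
    obtain b c where bc: "b \<in> B" "c \<in> B" "x \<preceq> b" "y \<preceq> c"
      using xy by (auto simp: D_def)
    have c: "x \<in> carrier L" "y \<in> carrier L" "b \<in> carrier L" "c \<in> carrier L"
      using xy bc B by (auto simp: D_def)
    obtain d e where de: "d \<in> B" "e \<in> B" "b \<oplus> c \<preceq> d" "b \<otimes> c \<preceq> e"
      using add[of b c] mult[of b c] bc by auto
    have dc: "d \<in> carrier L" "e \<in> carrier L" using de B by auto
    have "x \<oplus> y \<preceq> b \<oplus> c" "x \<otimes> y \<preceq> b \<otimes> c"
      using bc c by (simp_all add: add_mono mult_mono)
    then have "x \<oplus> y \<preceq> d" "x \<otimes> y \<preceq> e"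
      using de dc c by (meson le_trans add.m_closed m_closed)+
    then show "x \<oplus> y \<in> D" "x \<otimes> y \<in> D" using de c by (auto simp: D_def)
  qed
  then show "subsemiring D L"
    using B by (auto simp: subsemiring_def D_def intro: le_refl)
  show "saturated D L"
    unfolding saturated_def D_def using B(1) by (blast intro: le_trans)
  show "B \<subseteq> D"
    using B(1) by (auto simp: D_def intro: le_refl)
qed

lemma adjoin_subset:
  "\<lbrakk>subsemiring S L; saturated S L; \<O> \<subseteq> S; s \<in> S\<rbrakk>
    \<Longrightarrow> adjoin (L\<lparr>carrier := \<O>\<rparr>) L (\<lambda>x. x) s \<subseteq> S"
  by (auto simp: adjoin_def)

lemma adjoin_pow:
  assumes "s \<in> carrier L"
  shows "s [^] (n::nat) \<in> adjoin (L\<lparr>carrier := \<O>\<rparr>) L (\<lambda>x. x) s"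
proof -
  have "s [^] n \<in> S" if "subsemiring S L" "s \<in> S" for S
    using that by (induction n) (auto simp: subsemiring_def)
  then show ?thesis by (auto simp: adjoin_def)
qed

lemma integral_imp_val:
  assumes s: "s \<in> K" and int: "integral_over (L\<lparr>carrier := \<O>\<rparr>) L (\<lambda>x. x) s"
  shows "s \<in> \<O>"
proof (rule ccontr)
  assume "s \<notin> \<O>"
  then have vs: "can_le E \<one>\<^bsub>E\<^esub> (v s)" using s not_val by blast
  let ?A = "adjoin (L\<lparr>carrier := \<O>\<rparr>) L (\<lambda>x. x) s"
  let ?B = "{k \<in> K. \<exists>n::nat. can_le E (v k) (v s [^]\<^bsub>E\<^esub> n)}"
  let ?D = "{x \<in> carrier L. \<exists>b\<in>?B. x \<preceq> b}"
  have B: "\<exists>d\<in>?B. k \<oplus> l \<preceq> d" "\<exists>d\<in>?B. k \<otimes> l \<preceq> d" if kl: "k \<in> ?B" "l \<in> ?B" for k l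
  proof -
    obtain n m :: nat where nm: "can_le E (v k) (v s [^]\<^bsub>E\<^esub> n)" "can_le E (v l) (v s [^]\<^bsub>E\<^esub> m)"
      and c: "k \<in> K" "l \<in> K"
      using kl by auto
    have "can_le E (v k) (v s [^]\<^bsub>E\<^esub> (n + m))" "can_le E (v l) (v s [^]\<^bsub>E\<^esub> (n + m))"
      using nm E.pow_mono_exp[OF vs] c s by (meson E.le_trans E.nat_pow_closed v_closed)+
    then have "k \<oplus> l \<in> ?B"
      using c s K_closed by (auto intro!: exI[of _ "n + m"] E.add_least)
    moreover have "can_le E (v k \<otimes>\<^bsub>E\<^esub> v l) (v s [^]\<^bsub>E\<^esub> n \<otimes>\<^bsub>E\<^esub> v s [^]\<^bsub>E\<^esub> m)"
      using nm c s by (intro E.mult_mono) auto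
    then have "k \<otimes> l \<in> ?B"
      using c s K_closed by (auto intro!: exI[of _ "n + m"] simp: E.nat_pow_mult)
    ultimately show "\<exists>d\<in>?B. k \<oplus> l \<preceq> d" "\<exists>d\<in>?B. k \<otimes> l \<preceq> d"
      using c K_closed le_refl by (meson add.m_closed m_closed)+
  qed
  have B': "?B \<subseteq> carrier L" "\<zero> \<in> ?B" "\<one> \<in> ?B"
    using K_closed s by (auto simp: E.zero_le E.le_refl intro!: exI[of _ "0::nat"])
  note D = saturated_down_closure[OF B' B]
  have "\<O> \<subseteq> ?B" "s \<in> ?B"
    using s by (auto simp: val_iff E.le_refl intro: exI[of _ "0::nat"] exI[of _ "1::nat"])
  then have AD: "?A \<subseteq> ?D" using D by (intro adjoin_subset) auto
  obtain m where m: "m \<in> ?A" and mb: "\<forall>y\<in>?A. \<exists>r\<in>\<O>. y \<preceq> r \<otimes> m"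
    using int by (auto simp: integral_over_def finite_semimodule_def alg_module_def can_le_def)
  obtain k n where k: "m \<preceq> k" "k \<in> K" "m \<in> carrier L" "can_le E (v k) (v s [^]\<^bsub>E\<^esub> (n::nat))"
    using m AD by blast
  obtain r where r: "r \<in> \<O>" "s [^] Suc n \<preceq> r \<otimes> m"
    using mb adjoin_pow[of s "Suc n"] K_closed(1)[OF s] by blast
  have "r \<otimes> m \<preceq> r \<otimes> k"
    using k r K_closed val_carrier by (intro mult_left_mono) auto
  then have "s [^] Suc n \<preceq> r \<otimes> k"
    using r k K_closed(1) s val_carrier by (meson le_trans nat_pow_closed m_closed)
  then have 1: "can_le E (v s [^]\<^bsub>E\<^esub> Suc n) (v r \<otimes>\<^bsub>E\<^esub> v k)"
    using v_mono[of "s [^] Suc n" "r \<otimes> k"] pow_K[OF s, of "Suc n"] v_pow[OF s, of "Suc n"]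
      k r val_K K_closed by (simp del: nat_pow_Suc)
  have "can_le E (v r \<otimes>\<^bsub>E\<^esub> v k) (\<one>\<^bsub>E\<^esub> \<otimes>\<^bsub>E\<^esub> v s [^]\<^bsub>E\<^esub> n)"
    using r k s by (intro E.mult_mono) (auto simp: val_iff)
  with 1 have 2: "can_le E (v s [^]\<^bsub>E\<^esub> n \<otimes>\<^bsub>E\<^esub> v s) (v s [^]\<^bsub>E\<^esub> n)"
    using r k s val_K by (auto intro: E.le_trans)
  have "v s \<noteq> \<zero>\<^bsub>E\<^esub>"
    using vs E.zero_neq_one E.le_zero[of "\<one>\<^bsub>E\<^esub>"] by auto
  then have "v s \<in> Units E"
    using E.nonzero_unit s by simp
  then have "v s [^]\<^bsub>E\<^esub> n \<in> Units E"
    by (induct n) simp_all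
  then obtain t where t: "t \<in> carrier E" "t \<otimes>\<^bsub>E\<^esub> v s [^]\<^bsub>E\<^esub> n = \<one>\<^bsub>E\<^esub>"
    by (auto simp: Units_def)
  have "can_le E (t \<otimes>\<^bsub>E\<^esub> (v s [^]\<^bsub>E\<^esub> n \<otimes>\<^bsub>E\<^esub> v s)) (t \<otimes>\<^bsub>E\<^esub> v s [^]\<^bsub>E\<^esub> n)"
    using 2 t s by (intro E.mult_left_mono) auto
  moreover have "t \<otimes>\<^bsub>E\<^esub> (v s [^]\<^bsub>E\<^esub> n \<otimes>\<^bsub>E\<^esub> v s) = v s"
    using t s by (simp add: E.m_assoc[symmetric])
  ultimately show False using t s \<open>s \<notin> \<O>\<close> by (simp add: val_iff)
qed

lemma quasiintegral_multiplier:
  assumes s: "s \<in> carrier L" and p: "p \<in> carrier L" "\<one> \<preceq> p"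
    and r: "r \<in> \<O>" "s \<otimes> p \<preceq> r \<otimes> p"
  shows "quasiintegral_over (L\<lparr>carrier := \<O>\<rparr>) L (\<lambda>x. x) s"
proof -
  let ?A = "adjoin (L\<lparr>carrier := \<O>\<rparr>) L (\<lambda>x. x) s"
  let ?S = "{x \<in> carrier L. \<exists>r\<in>\<O>. x \<otimes> p \<preceq> r \<otimes> p}"
  let ?N = "{x \<in> carrier L. \<exists>r\<in>\<O>. x \<preceq> r \<otimes> p}"
  have S: "x \<oplus> y \<in> ?S" "x \<otimes> y \<in> ?S" if "x \<in> ?S" "y \<in> ?S" for x y
  proof -
    obtain a b where ab: "a \<in> \<O>" "b \<in> \<O>" "x \<otimes> p \<preceq> a \<otimes> p" "y \<otimes> p \<preceq> b \<otimes> p"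
      and c: "x \<in> carrier L" "y \<in> carrier L"
      using \<open>x \<in> ?S\<close> \<open>y \<in> ?S\<close> by auto
    note c = c ab(1,2)[THEN val_carrier] p(1)
    have "(x \<oplus> y) \<otimes> p \<preceq> (a \<oplus> b) \<otimes> p"
      using ab c by (simp add: l_distr add_mono)
    then show "x \<oplus> y \<in> ?S" using c ab val_closed(3) by blast
    have "x \<otimes> (y \<otimes> p) \<preceq> x \<otimes> (b \<otimes> p)" "b \<otimes> (x \<otimes> p) \<preceq> b \<otimes> (a \<otimes> p)"
      using ab c by (simp_all add: mult_left_mono)
    moreover have "x \<otimes> (b \<otimes> p) = b \<otimes> (x \<otimes> p)"
      using c by (simp add: m_ac)
    ultimately have "x \<otimes> (y \<otimes> p) \<preceq> b \<otimes> (a \<otimes> p)"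
      using le_trans[of "x \<otimes> (y \<otimes> p)" "b \<otimes> (x \<otimes> p)"] c by simp
    then have "(x \<otimes> y) \<otimes> p \<preceq> (b \<otimes> a) \<otimes> p"
      using c by (simp add: m_assoc)
    then show "x \<otimes> y \<in> ?S" using c ab val_closed(4) by blast
  qed
  have "\<O> \<subseteq> ?S" using p val_carrier by (auto intro: le_refl)
  then have "subsemiring ?S L"
    using S val_closed(1,2) by (auto simp: subsemiring_def)
  moreover have "saturated ?S L"
    unfolding saturated_def
  proof clarify
    fix z y r assume *: "z \<in> carrier L" "z \<preceq> y" "y \<in> carrier L" "r \<in> \<O>" "y \<otimes> p \<preceq> r \<otimes> p"
    then have "z \<otimes> p \<preceq> y \<otimes> p" using p by (simp add: mult_right_mono)
    then have "z \<otimes> p \<preceq> r \<otimes> p"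
      using * p val_carrier by (meson le_trans m_closed)
    then show "\<exists>r\<in>\<O>. z \<otimes> p \<preceq> r \<otimes> p" using * by blast
  qed
  moreover have "s \<in> ?S" using s r by blast
  ultimately have AS: "?A \<subseteq> ?S" using \<open>\<O> \<subseteq> ?S\<close> adjoin_subset by blast
  have pN: "p \<in> ?N" using p val_closed(2) by (auto intro!: bexI[of _ \<one>] le_refl)
  have "x \<oplus> y \<in> ?N" if "x \<in> ?N" "y \<in> ?N" for x y
  proof -
    obtain a b where ab: "a \<in> \<O>" "b \<in> \<O>" "x \<preceq> a \<otimes> p" "y \<preceq> b \<otimes> p"
      and c: "x \<in> carrier L" "y \<in> carrier L"
      using \<open>x \<in> ?N\<close> \<open>y \<in> ?N\<close> by auto
    then have "x \<oplus> y \<preceq> (a \<oplus> b) \<otimes> p"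
      using val_carrier p(1) by (simp add: l_distr add_mono)
    then show ?thesis using c ab val_closed(3) by blast
  qed
  moreover have "x \<otimes> y \<in> ?N" if "x \<in> ?A" "y \<in> ?N" for x y
  proof -
    obtain a b where ab: "a \<in> \<O>" "b \<in> \<O>" "x \<otimes> p \<preceq> a \<otimes> p" "y \<preceq> b \<otimes> p"
      and c: "x \<in> carrier L" "y \<in> carrier L"
      using \<open>x \<in> ?A\<close> AS \<open>y \<in> ?N\<close> by auto
    note c = c ab(1,2)[THEN val_carrier] p(1)
    have "x \<otimes> y \<preceq> x \<otimes> (b \<otimes> p)" "b \<otimes> (x \<otimes> p) \<preceq> b \<otimes> (a \<otimes> p)"
      using ab c by (simp_all add: mult_left_mono)
    moreover have "x \<otimes> (b \<otimes> p) = b \<otimes> (x \<otimes> p)"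
      using c by (simp add: m_ac)
    ultimately have "x \<otimes> y \<preceq> b \<otimes> (x \<otimes> p)" "b \<otimes> (x \<otimes> p) \<preceq> b \<otimes> (a \<otimes> p)"
      by simp_all
    then have "x \<otimes> y \<preceq> b \<otimes> (a \<otimes> p)"
      using le_trans[of "x \<otimes> y" "b \<otimes> (x \<otimes> p)"] c by simp
    then have "x \<otimes> y \<preceq> (b \<otimes> a) \<otimes> p"
      using c by (simp add: m_assoc)
    then show ?thesis using c ab val_closed(4) by blast
  qed
  moreover have "\<zero> \<in> ?N" using p val_closed by (auto intro!: bexI[of _ \<one>] zero_le)
  ultimately have "subsemimodule (L\<lparr>carrier := ?A\<rparr>) ?N (alg_module L (\<lambda>a. a) (carrier L))"
    by (auto simp: subsemimodule_def alg_module_def)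
  moreover have "finite_semimodule (L\<lparr>carrier := \<O>\<rparr>) (alg_module L (\<lambda>a. a) ?N)"
    unfolding finite_semimodule_def using pN
    by (intro bexI[of _ p]) (auto simp: alg_module_def can_le_def)
  moreover have "c = \<zero>" if "c \<in> ?A" "c \<otimes> p = \<zero>" for c
  proof -
    have "c \<in> carrier L" using that AS by auto
    then show ?thesis using mult_left_mono[of \<one> p c] p that le_zero by simp
  qed
  then have "faithful_semimodule (L\<lparr>carrier := ?A\<rparr>) (alg_module L (\<lambda>a. a) ?N)"
    unfolding faithful_semimodule_def using pN
    by (intro ballI impI bexI[of _ p]) (auto simp: alg_module_def)
  ultimately show ?thesis
    unfolding quasiintegral_over_def Let_def by blast
qed

lemma admissible_val:
  assumes ext: "extensible (L\<lparr>carrier := \<O>\<rparr>) L (\<lambda>x. x)"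
  shows "admissible {x \<in> carrier L. \<exists>b\<in>\<O>. x \<preceq> b}" (is "admissible ?D")
proof -
  have "\<O> \<subseteq> carrier L" using val_carrier by auto
  moreover have "\<exists>d\<in>\<O>. b \<oplus> c \<preceq> d" "\<exists>d\<in>\<O>. b \<otimes> c \<preceq> d" if "b \<in> \<O>" "c \<in> \<O>" for b c
    using that val_closed(3,4) val_carrier le_refl by blast+
  ultimately have D: "subsemiring ?D L" "saturated ?D L" "\<O> \<subseteq> ?D"
    using saturated_down_closure[of \<O>] val_closed(1,2) by auto
  have False if p: "p \<in> carrier L" "\<one> \<preceq> p" and a: "a \<in> ?D" and s: "s \<in> K" "s \<notin> \<O>"
    and le: "s \<otimes> p \<preceq> a \<otimes> p" for p a s
  proof -
    obtain r where r: "r \<in> \<O>" "a \<preceq> r" and c: "a \<in> carrier L" using a by auto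
    have sc: "s \<in> carrier L" using s K_closed by blast
    have "a \<otimes> p \<preceq> r \<otimes> p" using r c p val_carrier by (simp add: mult_right_mono)
    then have "s \<otimes> p \<preceq> r \<otimes> p" using le r c p val_carrier sc by (meson le_trans m_closed)
    then have "quasiintegral_over (L\<lparr>carrier := \<O>\<rparr>) L (\<lambda>x. x) s"
      using quasiintegral_multiplier sc p r(1) by blast
    then show False using ext sc integral_imp_val s by (auto simp: extensible_def)
  qed
  then show ?thesis unfolding admissible_def using D by blast
qed

lemma admissible_Union:
  assumes C: "\<C> \<noteq> {}" "subset.chain (Collect admissible) \<C>"
  shows "admissible (\<Union>\<C>)"
proof -
  have adm: "admissible A" if "A \<in> \<C>" for A using C that by (auto simp: subset.chain_def)
  obtain A0 where A0: "A0 \<in> \<C>" using C by auto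
  have "x \<oplus> y \<in> \<Union>\<C>" "x \<otimes> y \<in> \<Union>\<C>" if xy: "x \<in> \<Union>\<C>" "y \<in> \<Union>\<C>" for x y
  proof -
    obtain A B where AB: "A \<in> \<C>" "B \<in> \<C>" "x \<in> A" "y \<in> B" using xy by auto
    then have "A \<subseteq> B \<or> B \<subseteq> A" using C by (auto simp: subset.chain_def)
    then obtain D where "D \<in> \<C>" "x \<in> D" "y \<in> D" using AB by blast
    then show "x \<oplus> y \<in> \<Union>\<C>" "x \<otimes> y \<in> \<Union>\<C>" using adm admissible_closed(4,5) by blast+
  qed
  moreover have "\<Union>\<C> \<subseteq> carrier L" "\<zero> \<in> \<Union>\<C>" "\<one> \<in> \<Union>\<C>" "\<O> \<subseteq> \<Union>\<C>"
    using adm A0 admissible_closed(1,2,3,7) by blast+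
  moreover have "saturated (\<Union>\<C>) L"
    unfolding saturated_def using adm admissible_closed(6) by blast
  moreover have "\<forall>p\<in>carrier L. \<forall>a\<in>\<Union>\<C>. \<forall>s\<in>K - \<O>. \<one> \<preceq> p \<longrightarrow> \<not> s \<otimes> p \<preceq> a \<otimes> p"
    using adm admissibleD by blast
  ultimately show ?thesis by (simp add: admissible_def subsemiring_def)
qed

lemma maximal_admissible_exists:
  assumes "extensible (L\<lparr>carrier := \<O>\<rparr>) L (\<lambda>x. x)"
  shows "\<exists>A. admissible A \<and> (\<forall>B. admissible B \<and> A \<subseteq> B \<longrightarrow> B = A)"
  using subset_Zorn_nonempty[of "Collect admissible"] admissible_val[OF assms] admissible_Union
  by blast

lemma multiplier_of_not_mem:
  assumes A: "admissible A" and max: "\<And>B. \<lbrakk>admissible B; A \<subseteq> B\<rbrakk> \<Longrightarrow> B = A"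
    and u: "u \<in> carrier L" "u \<notin> A"
  obtains p a s n where "p \<in> carrier L" "\<one> \<preceq> p" "a \<in> A" "s \<in> K" "s \<notin> \<O>"
    "s \<otimes> p \<preceq> a \<otimes> ((\<one> \<oplus> u) [^] (n::nat) \<otimes> p)"
proof -
  let ?w = "\<one> \<oplus> u"
  let ?B = "{a \<otimes> ?w [^] (n::nat) | a n. a \<in> A}"
  let ?D = "{x \<in> carrier L. \<exists>b\<in>?B. x \<preceq> b}"
  have w: "?w \<in> carrier L" "\<one> \<preceq> ?w" using u le_add1 by auto
  have B: "\<exists>d\<in>?B. b \<oplus> c \<preceq> d" "\<exists>d\<in>?B. b \<otimes> c \<preceq> d" if bc: "b \<in> ?B" "c \<in> ?B" for b c
  proof -
    obtain a n a' m where e: "b = a \<otimes> ?w [^] (n::nat)" "c = a' \<otimes> ?w [^] (m::nat)"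
      and a: "a \<in> A" "a' \<in> A" using bc by auto
    note ac = a[THEN admissible_closed(1)[OF A]]
    have "b \<preceq> a \<otimes> ?w [^] (n + m)" "c \<preceq> a' \<otimes> ?w [^] (n + m)"
      using e ac w pow_mono_exp[OF w(2,1)] by (simp_all add: mult_left_mono)
    then have "b \<oplus> c \<preceq> a \<otimes> ?w [^] (n + m) \<oplus> a' \<otimes> ?w [^] (n + m)"
      using e ac w by (intro add_mono) auto
    then have "b \<oplus> c \<preceq> (a \<oplus> a') \<otimes> ?w [^] (n + m)"
      using ac w by (simp add: l_distr)
    then show "\<exists>d\<in>?B. b \<oplus> c \<preceq> d" using admissible_closed(4)[OF A a] by blast
    have "b \<otimes> c = (a \<otimes> a') \<otimes> (?w [^] n \<otimes> ?w [^] m)"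
      using e ac w(1) by (simp add: m_ac)
    also have "\<dots> = (a \<otimes> a') \<otimes> ?w [^] (n + m)"
      using w(1) by (simp add: nat_pow_mult)
    finally have "b \<otimes> c \<preceq> (a \<otimes> a') \<otimes> ?w [^] (n + m)"
      using ac w by (simp add: le_refl)
    then show "\<exists>d\<in>?B. b \<otimes> c \<preceq> d" using admissible_closed(5)[OF A a] by blast
  qed
  have AB: "A \<subseteq> ?B"
  proof
    fix a assume "a \<in> A"
    then have "a = a \<otimes> ?w [^] (0::nat)" using admissible_closed(1)[OF A] by simp
    then show "a \<in> ?B" using \<open>a \<in> A\<close> by blast
  qed
  have "?B \<subseteq> carrier L" using admissible_closed(1)[OF A] w by auto
  moreover have "\<zero> \<in> ?B" "\<one> \<in> ?B" using AB admissible_closed(2,3)[OF A] by auto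
  ultimately have B': "?B \<subseteq> carrier L" "\<zero> \<in> ?B" "\<one> \<in> ?B" .
  note D = saturated_down_closure[OF B' B]
  have "u \<preceq> \<one> \<otimes> ?w [^] (1::nat)" using u le_add2 by simp
  then have "u \<in> ?D" using u admissible_closed(3)[OF A] by blast
  then have "\<not> admissible ?D" using max[of ?D] AB D u by blast
  moreover have "\<O> \<subseteq> ?D" using AB D admissible_closed(7)[OF A] by blast
  ultimately obtain p d s where p: "p \<in> carrier L" "\<one> \<preceq> p" and d: "d \<in> ?D"
    and s: "s \<in> K" "s \<notin> \<O>" and le: "s \<otimes> p \<preceq> d \<otimes> p"
    using D unfolding admissible_def by blast
  obtain a n where a: "a \<in> A" "d \<preceq> a \<otimes> ?w [^] (n::nat)" "d \<in> carrier L" using d by auto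
  note ac = admissible_closed(1)[OF A a(1)] K_closed(1)[OF s(1)]
  have "d \<otimes> p \<preceq> a \<otimes> ?w [^] n \<otimes> p" using a ac w p by (intro mult_right_mono) auto
  then have "s \<otimes> p \<preceq> a \<otimes> ?w [^] n \<otimes> p"
    using le_trans[OF le] a ac w p by simp
  then have "s \<otimes> p \<preceq> a \<otimes> (?w [^] n \<otimes> p)"
    using ac w p by (simp add: m_assoc)
  then show ?thesis using that p a(1) s by blast
qed

lemma scale_multiplier:
  assumes A: "admissible A" and a: "a \<in> A" and s: "s \<in> K" "t \<in> K" "t \<preceq>\<^sub>v s"
    and pq: "p \<in> carrier L" "q \<in> carrier L" and le: "s \<otimes> p \<preceq> a \<otimes> q"
  shows "\<exists>c\<in>A. t \<otimes> p \<preceq> c \<otimes> q"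
proof -
  obtain r where r: "r \<in> \<O>" "t \<preceq> r \<otimes> s" using val_divides s by blast
  note c = admissible_closed(1)[OF A a] val_carrier[OF r(1)] s(1,2)[THEN K_closed(1)] pq
  have "t \<otimes> p \<preceq> (r \<otimes> s) \<otimes> p" using r c by (intro mult_right_mono) auto
  moreover have "r \<otimes> (s \<otimes> p) \<preceq> r \<otimes> (a \<otimes> q)" using le c by (intro mult_left_mono) auto
  ultimately have "t \<otimes> p \<preceq> (r \<otimes> a) \<otimes> q"
    using le_trans[of "t \<otimes> p" "r \<otimes> (s \<otimes> p)" "r \<otimes> (a \<otimes> q)"] c by (simp add: m_assoc)
  moreover have "r \<otimes> a \<in> A" using admissible_closed(5,7)[OF A] r a by blast
  ultimately show ?thesis by blast
qed

text \<open>If neither \<open>u\<close> nor \<open>inv u\<close> could be adjoined, the two failures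
  \<open>s \<otimes> p \<preceq> c \<otimes> (\<one> \<oplus> u)\<^sup>n \<otimes> p\<close> and \<open>s \<otimes> p' \<preceq> c' \<otimes> (\<one> \<oplus> inv u)\<^sup>m \<otimes> p'\<close> would combine, with multiplier
  \<open>p \<otimes> p' \<otimes> (\<one> \<oplus> u)\<^sup>n\<^sup>+\<^sup>m\<close>, to a failure of admissibility for \<open>A\<close> itself.\<close>

lemma maximal_admissible_units:
  assumes A: "admissible A" and max: "\<And>B. \<lbrakk>admissible B; A \<subseteq> B\<rbrakk> \<Longrightarrow> B = A"
    and u: "u \<in> Units L"
  shows "u \<in> A \<or> inv u \<in> A"
proof (rule ccontr)
  assume "\<not> (u \<in> A \<or> inv u \<in> A)"
  then have nu: "u \<notin> A" "inv u \<notin> A" by auto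
  have uc: "u \<in> carrier L" "inv u \<in> carrier L" using u by auto
  let ?w = "\<one> \<oplus> u" and ?w' = "\<one> \<oplus> inv u"
  have w: "?w \<in> carrier L" "?w' \<in> carrier L" "\<one> \<preceq> ?w" using uc by (auto intro: le_add1)
  obtain p a s n where 1: "p \<in> carrier L" "\<one> \<preceq> p" "a \<in> A" "s \<in> K" "s \<notin> \<O>"
    "s \<otimes> p \<preceq> a \<otimes> (?w [^] (n::nat) \<otimes> p)"
    using multiplier_of_not_mem[OF A max uc(1) nu(1)] by blast
  obtain p' a' s' m where 2: "p' \<in> carrier L" "\<one> \<preceq> p'" "a' \<in> A" "s' \<in> K" "s' \<notin> \<O>"
    "s' \<otimes> p' \<preceq> a' \<otimes> (?w' [^] (m::nat) \<otimes> p')"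
    using multiplier_of_not_mem[OF A max uc(2) nu(2)] by blast
  obtain t where t: "t \<in> K" "t \<notin> \<O>" "t \<preceq>\<^sub>v s" "t \<preceq>\<^sub>v s'"
    using E.total[of "v s" "v s'"] 1(4,5) 2(4,5) E.le_refl v_closed by metis
  obtain c where c: "c \<in> A" "t \<otimes> p \<preceq> c \<otimes> (?w [^] n \<otimes> p)"
    using scale_multiplier[OF A 1(3,4) t(1,3) 1(1) _ 1(6)] 1(1) w by auto
  obtain c' where c': "c' \<in> A" "t \<otimes> p' \<preceq> c' \<otimes> (?w' [^] m \<otimes> p')"
    using scale_multiplier[OF A 2(3,4) t(1,4) 2(1) _ 2(6)] 2(1) w by auto
  let ?W = "?w [^] n" and ?V = "?w [^] m" and ?U = "u [^] m"
  have cl: "t \<in> carrier L" "c \<in> carrier L" "c' \<in> carrier L" "p \<in> carrier L" "p' \<in> carrier L"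
    "?W \<in> carrier L" "?V \<in> carrier L" "?U \<in> carrier L" "?w' [^] m \<in> carrier L"
    using t c c' admissible_closed(1)[OF A] K_closed(1) 1 2 w uc by auto
  have "u \<otimes> ?w' = ?w" using u uc by (simp add: r_distr a_comm)
  then have V: "?U \<otimes> ?w' [^] m = ?V" using nat_pow_distrib[OF uc(1) w(2)] by simp
  have "?U \<otimes> (t \<otimes> p') \<preceq> ?U \<otimes> (c' \<otimes> (?w' [^] m \<otimes> p'))"
    using c' cl by (intro mult_left_mono) auto
  also have "\<dots> = c' \<otimes> ((?U \<otimes> ?w' [^] m) \<otimes> p')"
    using cl by (simp add: m_ac)
  finally have 3: "?U \<otimes> (t \<otimes> p') \<preceq> c' \<otimes> (?V \<otimes> p')" by (simp add: V)
  let ?q = "p \<otimes> p' \<otimes> ?w [^] (n + m)"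
  have q: "?q = p \<otimes> p' \<otimes> (?W \<otimes> ?V)" "?q \<in> carrier L"
    using cl w by (simp_all add: nat_pow_mult)
  have "(t \<otimes> p) \<otimes> (p' \<otimes> ?V) \<preceq> (c \<otimes> (?W \<otimes> p)) \<otimes> (p' \<otimes> ?V)"
    using c cl by (intro mult_right_mono) auto
  also have "\<dots> = c \<otimes> ?q" unfolding q using cl by (simp add: m_ac)
  finally have 4: "(t \<otimes> p) \<otimes> (p' \<otimes> ?V) \<preceq> c \<otimes> ?q" .
  have "(?U \<otimes> (t \<otimes> p')) \<otimes> (p \<otimes> ?W) \<preceq> (c' \<otimes> (?V \<otimes> p')) \<otimes> (p \<otimes> ?W)"
    using 3 cl by (intro mult_right_mono) auto
  also have "\<dots> = c' \<otimes> ?q" unfolding q using cl by (simp add: m_ac)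
  finally have 5: "(?U \<otimes> (t \<otimes> p')) \<otimes> (p \<otimes> ?W) \<preceq> c' \<otimes> ?q" .
  have "t \<otimes> ?q = (t \<otimes> (p \<otimes> p')) \<otimes> ?w [^] (n + m)"
    using cl w by (simp add: m_assoc)
  moreover have "(t \<otimes> (p \<otimes> p')) \<otimes> ?w [^] (n + m) \<preceq> (t \<otimes> (p \<otimes> p')) \<otimes> (?V \<oplus> ?U \<otimes> ?W)"
    using pow_one_add_split[OF uc(1)] cl w by (intro mult_left_mono) auto
  moreover have "(t \<otimes> (p \<otimes> p')) \<otimes> (?V \<oplus> ?U \<otimes> ?W)
      = (t \<otimes> p) \<otimes> (p' \<otimes> ?V) \<oplus> (?U \<otimes> (t \<otimes> p')) \<otimes> (p \<otimes> ?W)"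
    using cl by (simp add: r_distr m_ac)
  ultimately have 6: "t \<otimes> ?q \<preceq> (t \<otimes> p) \<otimes> (p' \<otimes> ?V) \<oplus> (?U \<otimes> (t \<otimes> p')) \<otimes> (p \<otimes> ?W)"
    by simp
  have "(t \<otimes> p) \<otimes> (p' \<otimes> ?V) \<oplus> (?U \<otimes> (t \<otimes> p')) \<otimes> (p \<otimes> ?W) \<preceq> c \<otimes> ?q \<oplus> c' \<otimes> ?q"
    using 4 5 cl q(2) by (intro add_mono) auto
  then have "t \<otimes> ?q \<preceq> c \<otimes> ?q \<oplus> c' \<otimes> ?q"
    using le_trans[OF 6] cl q(2) by simp
  then have "t \<otimes> ?q \<preceq> (c \<oplus> c') \<otimes> ?q" using l_distr[OF cl(2,3) q(2)] by simp
  moreover have "\<one> \<preceq> ?q" using 1 2 w by (intro one_le_mult one_le_pow) auto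
  ultimately show False
    using admissibleD[OF A] q(2) admissible_closed(4)[OF A c(1) c'(1)] t by blast
qed

lemma admissible_pre_le_iff:
  assumes A: "admissible A" and xy: "x \<in> K" "y \<in> K"
  shows "pre_le A x y \<longleftrightarrow> x \<preceq>\<^sub>v y"
proof
  assume "x \<preceq>\<^sub>v y"
  then show "pre_le A x y"
    unfolding pre_le_def using val_divides[OF xy] admissible_closed(7)[OF A] by blast
next
  assume "pre_le A x y"
  then obtain a where a: "a \<in> A" "x \<preceq> a \<otimes> y" by (auto simp: pre_le_def)
  note c = admissible_closed(1)[OF A a(1)] xy[THEN K_closed(1)]
  show "x \<preceq>\<^sub>v y"
  proof (cases "y = \<zero>")
    case True
    then have "x = \<zero>" using a c le_zero by simp
    then show ?thesis using E.zero_le xy by simp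
  next
    case False
    then have "v y \<in> Units E" using xy v_eq_zero[OF xy(2)] E.nonzero_unit[of "v y"] by auto
    then obtain k where k: "k \<in> K" "v y \<otimes>\<^bsub>E\<^esub> v k = \<one>\<^bsub>E\<^esub>" "v k \<otimes>\<^bsub>E\<^esub> v y = \<one>\<^bsub>E\<^esub>"
      unfolding Units_def v_surj[symmetric] by blast
    have kc: "k \<in> carrier L" using k K_closed by blast
    have "y \<otimes> k \<in> \<O>" using k xy by (simp add: val_iff K_closed E.le_refl)
    have "x \<otimes> k \<preceq> a \<otimes> y \<otimes> k" using a c kc by (intro mult_right_mono) auto
    then have "(x \<otimes> k) \<otimes> \<one> \<preceq> (a \<otimes> (y \<otimes> k)) \<otimes> \<one>" using c kc by (simp add: m_assoc)
    moreover have "a \<otimes> (y \<otimes> k) \<in> A"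
      using a(1) \<open>y \<otimes> k \<in> \<O>\<close> admissible_closed(5,7)[OF A] by simp
    ultimately have "x \<otimes> k \<in> \<O>"
      using admissibleD[OF A, of "x \<otimes> k" \<one>] K_closed(5)[OF xy(1) k(1)] le_refl[of \<one>] by simp
    then have "can_le E (v x \<otimes>\<^bsub>E\<^esub> v k \<otimes>\<^bsub>E\<^esub> v y) (\<one>\<^bsub>E\<^esub> \<otimes>\<^bsub>E\<^esub> v y)"
      using xy k by (intro E.mult_right_mono) (auto simp: val_iff)
    then show ?thesis using xy k by (simp add: E.m_assoc)
  qed
qed

lemma maximal_pre_le_total_units:
  assumes A: "admissible A" and max: "\<And>B. \<lbrakk>admissible B; A \<subseteq> B\<rbrakk> \<Longrightarrow> B = A"
    and u: "u \<in> Units L" "t \<in> Units L"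
  shows "pre_le A u t \<or> pre_le A t u"
proof -
  have c: "u \<in> carrier L" "t \<in> carrier L" "inv u \<in> carrier L" "inv t \<in> carrier L"
    using u by auto
  have e: "(u \<otimes> inv t) \<otimes> t = u" "(t \<otimes> inv u) \<otimes> u = t"
    using u c by (simp_all add: m_assoc)
  have "(t \<otimes> inv u) \<otimes> (u \<otimes> inv t) = t \<otimes> (inv u \<otimes> u) \<otimes> inv t"
    using c by (simp add: m_assoc)
  then have "inv (u \<otimes> inv t) = t \<otimes> inv u"
    using u c by (intro comm_inv_char) (simp_all add: m_comm[of "u \<otimes> inv t"])
  then have "u \<otimes> inv t \<in> A \<or> t \<otimes> inv u \<in> A"
    using maximal_admissible_units[OF A max, of "u \<otimes> inv t"] u by simp
  then show ?thesis
    unfolding pre_le_def using e c le_refl by metis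
qed

lemma maximal_tot_ord_pre_quot:
  assumes A: "admissible A" and max: "\<And>B. \<lbrakk>admissible B; A \<subseteq> B\<rbrakk> \<Longrightarrow> B = A"
  shows "tot_ord_idem_semifield (pre_quot A)"
proof -
  have sub: "subsemiring A L" using A by (simp add: admissible_def)
  interpret Q: idempotent_semiring "pre_quot A" by (rule idempotent_semiring_pre_quot[OF sub])
  note simps = pre_quot_simps[OF sub] pre_quot_ops[OF sub]
  have cases: "pre_class A x = pre_class A \<zero> \<or> (\<exists>u\<in>Units L. pre_class A x = pre_class A u)"
    if "x \<in> carrier L" for x
    using that
  proof (induction x rule: unit_sum_induct)
    case (add u y)
    have uc: "u \<in> carrier L" using add(1) by auto
    have sum: "pre_class A (u \<oplus> y) = pre_class A u \<oplus>\<^bsub>pre_quot A\<^esub> pre_class A y"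
      using uc add(2) by (simp add: simps)
    from add(3) show ?case
    proof (elim disjE bexE)
      assume "pre_class A y = pre_class A \<zero>"
      then have "pre_class A (u \<oplus> y) = pre_class A u" using sum uc by (simp add: simps)
      then show ?thesis using add(1) by blast
    next
      fix t assume t: "t \<in> Units L" "pre_class A y = pre_class A t"
      have tc: "t \<in> carrier L" using t by auto
      have "can_le (pre_quot A) (pre_class A u) (pre_class A t)
          \<or> can_le (pre_quot A) (pre_class A t) (pre_class A u)"
        using maximal_pre_le_total_units[OF A max add(1) t(1)] uc tc can_le_pre_quot[OF sub] by blast
      then have "pre_class A (u \<oplus> y) \<in> {pre_class A t, pre_class A u}"
        unfolding sum t(2) can_le_def
        using Q.a_comm[of "pre_class A u" "pre_class A t"] uc tc pre_quot_simps(1)[OF sub]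
        by auto
      then show ?thesis using add(1) t(1) by blast
    qed
  qed simp
  show ?thesis
  proof
    have "\<not> pre_le A \<one> \<zero>"
      using admissible_pre_le_iff[OF A, of \<one> \<zero>] K_closed E.le_zero[of "\<one>\<^bsub>E\<^esub>"] E.zero_neq_one
      by auto
    then show "\<zero>\<^bsub>pre_quot A\<^esub> \<noteq> \<one>\<^bsub>pre_quot A\<^esub>"
      using pre_class_eq_iff[OF sub, of \<zero> \<one>] by (simp add: simps)
  next
    fix X assume X: "X \<in> carrier (pre_quot A)" "X \<noteq> \<zero>\<^bsub>pre_quot A\<^esub>"
    then obtain x where "x \<in> carrier L" "X = pre_class A x" by (auto simp: simps)
    then obtain u where u: "u \<in> Units L" "X = pre_class A u"
      using cases X(2) by (auto simp: simps)
    have uc: "u \<in> carrier L" "inv u \<in> carrier L" using u(1) by auto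
    have "pre_class A (inv u) \<otimes>\<^bsub>pre_quot A\<^esub> X = \<one>\<^bsub>pre_quot A\<^esub>"
      "X \<otimes>\<^bsub>pre_quot A\<^esub> pre_class A (inv u) = \<one>\<^bsub>pre_quot A\<^esub>"
      using u uc by (simp_all add: simps)
    moreover have "pre_class A (inv u) \<in> carrier (pre_quot A)" using uc by (simp add: simps)
    ultimately show "X \<in> Units (pre_quot A)" using X(1) unfolding Units_def by blast
  next
    fix X Y assume "X \<in> carrier (pre_quot A)" "Y \<in> carrier (pre_quot A)"
    then obtain x y where xy: "x \<in> carrier L" "X = pre_class A x" "y \<in> carrier L" "Y = pre_class A y"
      by (auto simp: simps)
    have Z: "can_le (pre_quot A) (pre_class A \<zero>) (pre_class A z)" if "z \<in> carrier L" for z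
      using that by (simp add: can_le_pre_quot[OF sub] le_imp_pre_le[OF sub] zero_le)
    from cases[OF xy(1)] cases[OF xy(3)]
    show "can_le (pre_quot A) X Y \<or> can_le (pre_quot A) Y X"
    proof (elim disjE bexE)
      fix u t assume ut: "u \<in> Units L" "pre_class A x = pre_class A u"
        "t \<in> Units L" "pre_class A y = pre_class A t"
      then show ?thesis
        using maximal_pre_le_total_units[OF A max ut(1,3)] can_le_pre_quot[OF sub, of u t]
          can_le_pre_quot[OF sub, of t u] xy by auto
    qed (use Z xy in auto)
  qed
qed

lemma valuation_extension:
  assumes A: "admissible A"
  defines "j \<equiv> \<lambda>e. pre_class A (inv_into K v e)"
  shows "j \<in> semiring_hom E (pre_quot A)" "inj_on j (carrier E)"
    and "x \<in> K \<Longrightarrow> j (v x) = pre_class A x"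
proof -
  have sub: "subsemiring A L" using A by (simp add: admissible_def)
  note simps = pre_quot_simps[OF sub] pre_quot_ops[OF sub]
  have eq: "pre_class A x = pre_class A y \<longleftrightarrow> v x = v y" if "x \<in> K" "y \<in> K" for x y
    using that pre_class_eq_iff[OF sub] admissible_pre_le_iff[OF A] K_closed(1)
      E.le_antisym[of "v x" "v y"] E.le_refl[of "v x"] by auto
  have j: "j (v x) = pre_class A x" if "x \<in> K" for x
    using that eq[of "inv_into K v (v x)" x] inv_into_into[of "v x" v K] f_inv_into_f[of "v x" v K]
    by (simp add: j_def)
  then show "x \<in> K \<Longrightarrow> j (v x) = pre_class A x" .
  have "j \<zero>\<^bsub>E\<^esub> = \<zero>\<^bsub>pre_quot A\<^esub>" "j \<one>\<^bsub>E\<^esub> = \<one>\<^bsub>pre_quot A\<^esub>"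
    using j[of \<zero>] j[of \<one>] K_closed by (simp_all add: simps)
  moreover have "j e \<in> carrier (pre_quot A)" if "e \<in> carrier E" for e
    using that j K_closed(1) unfolding v_surj[symmetric] by (auto simp: simps)
  moreover have "j (e \<oplus>\<^bsub>E\<^esub> f) = j e \<oplus>\<^bsub>pre_quot A\<^esub> j f \<and> j (e \<otimes>\<^bsub>E\<^esub> f) = j e \<otimes>\<^bsub>pre_quot A\<^esub> j f"
    if ef: "e \<in> carrier E" "f \<in> carrier E" for e f
  proof -
    obtain x y where xy: "x \<in> K" "y \<in> K" "e = v x" "f = v y"
      using ef unfolding v_surj[symmetric] by auto
    then show ?thesis
      using j[of "x \<oplus> y"] j[of "x \<otimes> y"] j[of x] j[of y] K_closed by (simp add: simps)
  qed
  ultimately show "j \<in> semiring_hom E (pre_quot A)"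
    by (auto simp: semiring_hom_def intro!: ring_hom_memI)
  show "inj_on j (carrier E)"
    unfolding v_surj[symmetric] using j eq by (auto intro!: inj_onI)
qed

end

theorem theorem8p12:
  fixes L :: "('a, 'm) ring_scheme" and K :: "'a set"
    and E :: "('e, 'n) ring_scheme" and v :: "'a \<Rightarrow> 'e" and i :: "'a \<Rightarrow> 'a"
  assumes "unitgenerated_idem_semiring L"
    and "subsemiring K L"
    and "unitgenerated_idem_semiring (L\<lparr>carrier := K\<rparr>)"
    and "tot_ord_idem_semifield E"
    and "v \<in> semiring_hom (L\<lparr>carrier := K\<rparr>) E"
    and "v ` K = carrier E"
    and i_incl: "i = (\<lambda>x. x)"
    and "extensible (L\<lparr>carrier := val_ring K E v\<rparr>) L i"
  shows "\<exists>(F :: 'a set ring) j w.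
           tot_ord_idem_semifield F \<and>
           j \<in> semiring_hom E F \<and> inj_on j (carrier E) \<and>
           w \<in> semiring_hom L F \<and>
           (\<forall>x\<in>K. w (i x) = j (v x))"
proof -
  interpret valued_subsemiring L E K v
    using assms by (simp add: valued_subsemiring_def valued_subsemiring_axioms_def)
  obtain A where A: "admissible A" and max: "\<And>B. \<lbrakk>admissible B; A \<subseteq> B\<rbrakk> \<Longrightarrow> B = A"
    using maximal_admissible_exists assms(8) unfolding i_incl by blast
  have "pre_class A \<in> semiring_hom L (pre_quot A)"
    using A pre_class_hom by (simp add: admissible_def)
  then show ?thesis
    using maximal_tot_ord_pre_quot[OF A max] valuation_extension[OF A] unfolding i_incl
    by metis
qed

end
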